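(* Let $W\ge1$ be an integer, let $\mathbf{t}\in\mathbb{C}^W$, let $\mathbf{F}$ be the $W\times W$ unitary discrete Fourier transform matrix ($\mathbf{F}^H\mathbf{F}=\mathbf{I}$), and let $\mathbf{T}=\mathbf{F}^H\mathrm{diag}(\mathbf{t})$. Let $\mathcal{Q}$ be the complex-valued scalar quantizer described in the context (applied entrywise to vectors), and consider the quantized observation $\mathbf{q}=\mathcal{Q}(\mathbf{T}\mathbf{h}+\mathbf{n})$, where $\mathbf{n}\in\mathbb{C}^W$ has i.i.d. circularly symmetric complex Gaussian entries of variance $N_0>0$ and the channel vector $\mathbf{h}\in\mathbb{C}^W$ has probability density function $f$. If $f$ is log-concave (i.e. $-\log f$ is convex), then for every $\mathbf{q}$ the maximum a-posteriori channel-estimation problem $$\underset{\tilde{\mathbf{h}}\in\mathbb{C}^W}{\text{minimize}}\ \Bigl\{-\log p(\mathbf{q}\,|\,\mathbf{T}\tilde{\mathbf{h}})-\log f(\tilde{\mathbf{h}})\Bigr\}$$ is a convex optimization problem, i.e. its objective function is convex in $\tilde{\mathbf{h}}\in\mathbb{C}^W$.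
   Context: Quantizer: fix an integer $Q\ge1$ and bin boundaries $-\infty=b_1<b_2<\cdots<b_Q<b_{Q+1}=+\infty$. For $s=s^R+is^I\in\mathbb{C}$, $\mathcal{Q}(s)=q^R+iq^I$, where $q^R\in\{1,\dots,Q\}$ is the index with $b_{q^R}\le s^R<b_{q^R+1}$ and $q^I\in\{1,\dots,Q\}$ is the index with $b_{q^I}\le s^I<b_{q^I+1}$. Likelihood: with $\sigma^2=N_0/2$ and $\Phi$ the standard normal cumulative distribution function ($\Phi(-\infty)=0$, $\Phi(+\infty)=1$), for a label $q=q^R+iq^I$ and $z=z^R+iz^I\in\mathbb{C}$, $$p(q\,|\,z)=\left[\Phi\!\left(\tfrac{b_{q^R+1}-z^R}{\sigma}\right)-\Phi\!\left(\tfrac{b_{q^R}-z^R}{\sigma}\right)\right]\left[\Phi\!\left(\tfrac{b_{q^I+1}-z^I}{\sigma}\right)-\Phi\!\left(\tfrac{b_{q^I}-z^I}{\sigma}\right)\right],$$ and for vectors $p(\mathbf{q}\,|\,\mathbf{z})=\prod_{w=1}^W p(q_w\,|\,z_w)$. This is the conditional probability of $\mathbf{q}=\mathcal{Q}(\mathbf{z}+\mathbf{n})$ given the noiseless signal $\mathbf{z}$. Convexity of functions on $\mathbb{C}^W$ is understood by identifying $\mathbb{C}^W$ with $\mathbb{R}^{2W}$; $-\log f$ may take the value $+\infty$ (where $f=0$), with convexity understood for extended-real-valued functions. $\mathrm{diag}(\mathbf{t})$ is the diagonal matrix with $\mathbf{t}$ on its diagonal, and $^H$ denotes conjugate transpose.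 *)

theory Defs
  imports "HOL-Probability.Probability"
begin

text \<open>
  Vectors in \<open>\<complex>\<^sup>W\<close> have type \<open>complex ^ 'w\<close> with \<open>W = CARD('w)\<close>. Since a finite type carries no
  canonical numbering, the DFT matrix takes a numbering \<open>idx\<close> of the coordinates, intended to be
  a bijection from \<open>'w\<close> onto \<open>{0, \<dots>, W - 1}\<close>.
\<close>

definition dft_matrix :: "('w \<Rightarrow> nat) \<Rightarrow> complex ^ 'w ^ 'w::finite" where
  "dft_matrix idx = (\<chi> j k. exp (- 2 * of_real pi * \<i> * of_nat (idx j) * of_nat (idx k)
      / of_nat CARD('w)) / of_real (sqrt (real CARD('w))))"

definition conj_transpose :: "complex ^ 'n ^ 'm \<Rightarrow> complex ^ 'm ^ 'n" where
  "conj_transpose A = (\<chi> i j. cnj (A $ j $ i))"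

definition diag_matrix :: "complex ^ 'n \<Rightarrow> complex ^ 'n ^ 'n" where
  "diag_matrix t = (\<chi> i j. if i = j then t $ i else 0)"

lemma dft_matrix_unitary:
  fixes idx :: "'w::finite \<Rightarrow> nat"
  assumes "bij_betw idx UNIV {..<CARD('w)}"
  shows "conj_transpose (dft_matrix idx) ** dft_matrix idx = mat 1"
proof -
  define W where "W = CARD('w)"
  have W: "W > 0" by (simp add: W_def)
  define z where "z i j = cis (2 * pi * (real (idx i) - real (idx j)) / real W)" for i j
  have entry: "cnj (dft_matrix idx $ k $ i) * dft_matrix idx $ k $ j
      = z i j ^ idx k / of_nat W" for i j k
  proof -
    have d: "dft_matrix idx $ k $ i
        = cis (- (2 * pi * real (idx k) * real (idx i) / real W)) / of_real (sqrt (real W))" for i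
      by (simp add: dft_matrix_def W_def cis_conv_exp mult_ac)
    have "cnj (dft_matrix idx $ k $ i) * dft_matrix idx $ k $ j
        = cis (2 * pi * real (idx k) * real (idx i) / real W
              - 2 * pi * real (idx k) * real (idx j) / real W)
          / of_real (sqrt (real W) * sqrt (real W))"
      by (simp add: d cis_cnj cis_mult del: real_sqrt_mult_self)
    also have "\<dots> = z i j ^ idx k / of_nat W"
      by (simp add: z_def Complex.DeMoivre right_diff_distrib diff_divide_distrib mult_ac)
    finally show ?thesis .
  qed
  have "(\<Sum>k\<in>UNIV. z i j ^ idx k / of_nat W) = (if i = j then 1 else 0)" for i j
  proof -
    have "(\<Sum>k\<in>UNIV. z i j ^ idx k / of_nat W) = (\<Sum>m<W. z i j ^ m / of_nat W)"
      using sum.reindex_bij_betw[OF assms, of "\<lambda>m. z i j ^ m / of_nat W"] by (simp add: W_def)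
    also have "\<dots> = (\<Sum>m<W. z i j ^ m) / of_nat W"
      by (simp add: sum_divide_distrib)
    also have "\<dots> = (if i = j then 1 else 0)"
    proof (cases "i = j")
      case True
      then show ?thesis using W by (simp add: z_def)
    next
      case False
      have lt: "idx i < W" "idx j < W" for i j
        using bij_betwE[OF assms] by (auto simp: W_def)
      have ne: "idx i \<noteq> idx j"
        using False assms by (auto simp: bij_betw_def inj_on_def)
      have "z i j ^ W = cis (2 * pi * of_int (int (idx i) - int (idx j)))"
        using W by (simp add: z_def Complex.DeMoivre)
      then have zW: "z i j ^ W = 1" by (simp add: cis_multiple_2pi)
      have "z i j \<noteq> 1"
      proof
        assume "z i j = 1"
        then have "cos (2 * pi * (real (idx i) - real (idx j)) / real W) = 1"
          by (simp add: z_def complex_eq_iff)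
        then obtain m :: int where
          "2 * pi * (real (idx i) - real (idx j)) / real W = of_int m * 2 * pi"
          by (auto simp: cos_one_2pi_int)
        then have "2 * pi * (real (idx i) - real (idx j)) = 2 * pi * (of_int m * real W)"
          using W by (simp add: field_simps)
        then have "real (idx i) - real (idx j) = of_int m * real W"
          by (simp only: mult_cancel_left) simp
        then have "of_int (int (idx i) - int (idx j)) = (of_int (m * int W) :: real)"
          by simp
        then have e: "int (idx i) - int (idx j) = m * int W"
          by (simp only: of_int_eq_iff)
        then have "int W dvd int (idx i) - int (idx j)" by simp
        moreover have "\<bar>int (idx i) - int (idx j)\<bar> < int W" using lt[of i] lt[of j] by auto
        ultimately have "int (idx i) - int (idx j) = 0"
          using zdvd_not_zless[of "\<bar>int (idx i) - int (idx j)\<bar>" "int W"]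
          by (metis abs_ge_zero abs_eq_0 dvd_abs_iff order_le_less)
        with ne show False by simp
      qed
      then show ?thesis using False zW by (simp add: geometric_sum)
    qed
    finally show ?thesis .
  qed
  then show ?thesis
    by (simp add: vec_eq_iff matrix_matrix_mult_def conj_transpose_def mat_def entry)
qed

definition bin_boundaries :: "nat \<Rightarrow> (nat \<Rightarrow> ereal) \<Rightarrow> bool" where
  "bin_boundaries Q b \<longleftrightarrow>
     b 1 = -\<infinity> \<and> b (Q + 1) = \<infinity> \<and> strict_mono_on {1..Q + 1} b"

definition bin_index :: "nat \<Rightarrow> (nat \<Rightarrow> ereal) \<Rightarrow> real \<Rightarrow> nat" where
  "bin_index Q b x = (THE k. k \<in> {1..Q} \<and> b k \<le> ereal x \<and> ereal x < b (k + 1))"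

definition quantize :: "nat \<Rightarrow> (nat \<Rightarrow> ereal) \<Rightarrow> complex \<Rightarrow> complex" where
  "quantize Q b s = of_nat (bin_index Q b (Re s)) + \<i> * of_nat (bin_index Q b (Im s))"

definition quantize_vec :: "nat \<Rightarrow> (nat \<Rightarrow> ereal) \<Rightarrow> complex ^ 'w \<Rightarrow> complex ^ 'w" where
  "quantize_vec Q b s = (\<chi> w. quantize Q b (s $ w))"

definition labels :: "nat \<Rightarrow> complex set" where
  "labels Q = {of_nat k + \<i> * of_nat l | k l. k \<in> {1..Q} \<and> l \<in> {1..Q}}"

definition label_vecs :: "nat \<Rightarrow> (complex ^ 'w) set" where
  "label_vecs Q = {q. \<forall>w. q $ w \<in> labels Q}"

definition Phi :: "ereal \<Rightarrow> real" where
  "Phi x = (case x of ereal r \<Rightarrow> cdf std_normal_distribution r | PInfty \<Rightarrow> 1 | MInfty \<Rightarrow> 0)"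

definition bin_likelihood :: "(nat \<Rightarrow> ereal) \<Rightarrow> real \<Rightarrow> nat \<Rightarrow> real \<Rightarrow> real" where
  "bin_likelihood b N0 k x =
     (let \<sigma> = sqrt (N0 / 2)
      in Phi ((b (k + 1) - ereal x) / ereal \<sigma>) - Phi ((b k - ereal x) / ereal \<sigma>))"

text \<open>
  The bin indices \<open>q\<^sup>R\<close>, \<open>q\<^sup>I\<close> are read off the complex label \<open>q = q\<^sup>R + i q\<^sup>I\<close>;
  rounding down is exact on \<open>labels Q\<close> and only converts the type.
\<close>

definition likelihood :: "(nat \<Rightarrow> ereal) \<Rightarrow> real \<Rightarrow> complex \<Rightarrow> complex \<Rightarrow> real" where
  "likelihood b N0 q z =
     bin_likelihood b N0 (nat \<lfloor>Re q\<rfloor>) (Re z) * bin_likelihood b N0 (nat \<lfloor>Im q\<rfloor>) (Im z)"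

definition likelihood_vec ::
    "(nat \<Rightarrow> ereal) \<Rightarrow> real \<Rightarrow> complex ^ 'w \<Rightarrow> complex ^ 'w \<Rightarrow> real" where
  "likelihood_vec b N0 q z = (\<Prod>w\<in>UNIV. likelihood b N0 (q $ w) (z $ w))"

text \<open>Density of a circularly symmetric complex Gaussian variable of variance \<open>N0\<close>.\<close>

definition complex_normal_density :: "real \<Rightarrow> complex \<Rightarrow> real" where
  "complex_normal_density N0 z = exp (- (cmod z)\<^sup>2 / N0) / (pi * N0)"

text \<open>
  \<open>- log\<close> of a nonnegative real, with value \<open>\<infinity>\<close> at \<open>0\<close>. (The library's \<open>ln 0 = 0\<close> would be wrong
  here.)
\<close>

definition neg_log :: "real \<Rightarrow> ereal" where
  "neg_log x = (if x \<le> 0 then \<infinity> else ereal (- ln x))"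

text \<open>
  Convexity of functions with values in \<open>(-\<infinity>, \<infinity>]\<close>; the library's \<open>convex_on\<close> is restricted
  to real-valued functions. Note that \<open>0 * \<infinity> = 0\<close> in \<open>ereal\<close>.
\<close>

definition ereal_convex_on :: "'a::real_vector set \<Rightarrow> ('a \<Rightarrow> ereal) \<Rightarrow> bool" where
  "ereal_convex_on S g \<longleftrightarrow> convex S \<and>
     (\<forall>x\<in>S. \<forall>y\<in>S. \<forall>u\<ge>0. \<forall>v\<ge>0. u + v = 1 \<longrightarrow>
        g (u *\<^sub>R x + v *\<^sub>R y) \<le> ereal u * g x + ereal v * g y)"

definition log_concave_fun :: "('a::real_vector \<Rightarrow> real) \<Rightarrow> bool" where
  "log_concave_fun f \<longleftrightarrow> ereal_convex_on UNIV (\<lambda>x. neg_log (f x))"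

definition map_objective ::
    "(nat \<Rightarrow> ereal) \<Rightarrow> real \<Rightarrow> complex ^ 'w ^ 'w \<Rightarrow> (complex ^ 'w \<Rightarrow> real) \<Rightarrow>
     complex ^ 'w \<Rightarrow> complex ^ 'w \<Rightarrow> ereal" where
  "map_objective b N0 T f q h = neg_log (likelihood_vec b N0 q (T *v h)) + neg_log (f h)"

end

theory Submission
  imports Defs
begin

text \<open>
  For real \<open>\<alpha> < \<beta>\<close> put \<open>g x = \<Phi> (\<beta> + x) - \<Phi> (\<alpha> + x)\<close> and let \<open>c = - g' / g\<close>, the mean of the
  normal distribution truncated to \<open>[\<alpha> + x, \<beta> + x]\<close>; it lies in this interval. Writing \<open>\<phi>\<close> for
  the normal density and \<open>l, r\<close> for the end points, \<open>g'\<^sup>2 - g g'' = g ((c - l) \<phi> l + (r - c) \<phi> r) \<ge> 0\<close>,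
  so \<open>- ln g\<close> is convex. Infinite end points follow by a pointwise limit. The likelihood is a
  product of such factors composed with real-affine maps of the channel vector.
\<close>

section \<open>The standard normal distribution function and its derivatives\<close>

abbreviation "std_normal_cdf \<equiv> cdf std_normal_distribution"

interpretation std_normal: real_distribution std_normal_distribution
  by (rule real_dist_normal_dist)

text \<open>Turns increments of the distribution function into integrals over closed intervals, the
  form to which the fundamental theorem of calculus applies.\<close>

lemma std_normal_cdf_diff:
  assumes "x < y"
  shows "std_normal_cdf y - std_normal_cdf x = integral {x..y} std_normal_density"
proof -
  have "std_normal_cdf y - std_normal_cdf x = measure std_normal_distribution {x<..y}"
    by (rule std_normal.cdf_diff_eq[OF assms])
  also have "\<dots> = (LINT z:{x<..y}|lborel. std_normal_density z)"
  proof -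
    have "measure std_normal_distribution {x<..y}
        = (LINT z|std_normal_distribution. indicator {x<..y} z)"
      by simp
    also have "\<dots> = (LINT z:{x<..y}|lborel. std_normal_density z)"
      by (subst integral_density)
         (simp_all add: normal_density_nonneg set_lebesgue_integral_def mult.commute)
    finally show ?thesis .
  qed
  also have "\<dots> = integral {x<..y} std_normal_density"
  proof (rule set_borel_integral_eq_integral)
    show "set_integrable lborel {x<..y} std_normal_density"
      unfolding set_integrable_def by (rule integrable_mult_indicator) auto
  qed
  also have "\<dots> = integral {x..y} std_normal_density"
    by (rule integral_spike_set) (auto intro!: negligible_subset[OF negligible_sing[of x]])
  finally show ?thesis .
qed

lemma DERIV_std_normal_density:
  "(std_normal_density has_real_derivative - x * std_normal_density x) (at x)"
proof -
  have "((\<lambda>x. 1 / sqrt (2 * pi) * exp (- x\<^sup>2 / 2)) has_real_derivative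
      1 / sqrt (2 * pi) * (exp (- x\<^sup>2 / 2) * (- x))) (at x)"
    by (rule DERIV_cmult) (auto intro!: derivative_eq_intros)
  then show ?thesis
    unfolding std_normal_density_def by (simp add: mult_ac)
qed

lemma DERIV_std_normal_cdf:
  "(std_normal_cdf has_real_derivative std_normal_density x) (at x)"
proof -
  \<comment> \<open>The window of radius 1 makes \<open>x\<close> an interior point, so integrating
    from the base point \<open>x - 1\<close> yields a two-sided derivative at
    \<open>x\<close>.\<close>
  have "continuous_on {x - 1..x + 1} std_normal_density"
    by (rule DERIV_continuous_on[OF has_field_derivative_at_within[OF DERIV_std_normal_density]])
  then have "((\<lambda>y. integral {x - 1..y} std_normal_density) has_real_derivative std_normal_density x)
      (at x within {x - 1..x + 1})"
    by (rule integral_has_real_derivative) auto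
  then have "((\<lambda>y. std_normal_cdf (x - 1) + integral {x - 1..y} std_normal_density)
      has_real_derivative std_normal_density x) (at x)"
    by (auto intro!: derivative_eq_intros simp: at_within_Icc_at)
  then show ?thesis
  proof (rule has_field_derivative_transform_within_open)
    show "open {x - 1<..<x + 1}" "x \<in> {x - 1<..<x + 1}" by auto
    show "std_normal_cdf (x - 1) + integral {x - 1..y} std_normal_density = std_normal_cdf y"
      if "y \<in> {x - 1<..<x + 1}" for y
      using std_normal_cdf_diff[of "x - 1" y] that by simp
  qed
qed

lemmas DERIV_std_normal_cdf' [derivative_intros] = DERIV_chain2[OF DERIV_std_normal_cdf]
lemmas DERIV_std_normal_density' [derivative_intros] = DERIV_chain2[OF DERIV_std_normal_density]

section \<open>Log-concavity of the normal probability of a sliding bounded interval\<close>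

lemma std_normal_cdf_strict_mono: "x < y \<Longrightarrow> std_normal_cdf x < std_normal_cdf y"
proof (rule DERIV_pos_imp_increasing[of x y std_normal_cdf])
  show "\<exists>d. (std_normal_cdf has_real_derivative d) (at z) \<and> d > 0" for z
    by (rule exI[of _ "std_normal_density z"]) (simp add: DERIV_std_normal_cdf normal_density_pos)
qed

text \<open>Since the density has derivative \<open>- z * std_normal_density z\<close>, the middle
  term is \<open>D\<close> times the mean of the normal law truncated to the interval. The bounds
  come from the function with derivative \<open>(m - z) * std_normal_density z\<close>, which is
  monotone on the interval for \<open>m = l\<close> and for \<open>m = r\<close>.\<close>

lemma std_normal_truncated_mean_bounds:
  assumes "l < r"
  defines "D \<equiv> std_normal_cdf r - std_normal_cdf l"
  shows "l * D \<le> std_normal_density l - std_normal_density r"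
    and "std_normal_density l - std_normal_density r \<le> r * D"
proof -
  have deriv: "((\<lambda>z. std_normal_density z + m * std_normal_cdf z) has_real_derivative
      (m - z) * std_normal_density z) (at z)" for m z
    by (auto intro!: derivative_eq_intros simp: algebra_simps)
  have pos: "std_normal_density z \<ge> 0" for z
    by (rule normal_density_nonneg)
  have "std_normal_density r + l * std_normal_cdf r \<le> std_normal_density l + l * std_normal_cdf l"
  proof (rule DERIV_nonpos_imp_nonincreasing[of l r])
    show "\<exists>d. ((\<lambda>z. std_normal_density z + l * std_normal_cdf z) has_real_derivative d) (at z)
        \<and> d \<le> 0" if "l \<le> z" "z \<le> r" for z
      using that deriv[of l z] pos[of z] by (intro exI conjI) (auto simp: mult_nonpos_nonneg)
  qed (use assms in simp)
  then show "l * D \<le> std_normal_density l - std_normal_density r"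
    by (simp add: D_def algebra_simps)
  have "std_normal_density l + r * std_normal_cdf l \<le> std_normal_density r + r * std_normal_cdf r"
  proof (rule DERIV_nonneg_imp_nondecreasing[of l r])
    show "\<exists>d. ((\<lambda>z. std_normal_density z + r * std_normal_cdf z) has_real_derivative d) (at z)
        \<and> 0 \<le> d" if "l \<le> z" "z \<le> r" for z
      using that deriv[of r z] pos[of z] by (intro exI conjI) auto
  qed (use assms in simp)
  then show "std_normal_density l - std_normal_density r \<le> r * D"
    by (simp add: D_def algebra_simps)
qed

text \<open>When both end points move at unit speed, \<open>D\<close> has first derivative
  \<open>std_normal_density r - std_normal_density l\<close> and second derivative the factor of
  \<open>D\<close> on the left. The claim is thus the condition for \<open>- ln D\<close> to have a
  nonnegative second derivative.\<close>

lemma std_normal_interval_second_derivative_bound: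
  assumes "l < r"
  defines "D \<equiv> std_normal_cdf r - std_normal_cdf l"
  shows "(l * std_normal_density l - r * std_normal_density r) * D
      \<le> (std_normal_density r - std_normal_density l)\<^sup>2"
proof -
  have D: "D > 0"
    using std_normal_cdf_strict_mono[OF assms(1)] by (simp add: D_def)
  define c where "c = (std_normal_density l - std_normal_density r) / D"
  have cD: "c * D = std_normal_density l - std_normal_density r"
    using D by (simp add: c_def)
  have "l \<le> c" "c \<le> r"
    using std_normal_truncated_mean_bounds[OF assms(1)] D
    by (simp_all add: c_def D_def pos_le_divide_eq pos_divide_le_eq)
  \<comment> \<open>Both summands are nonnegative because the truncated mean \<open>c\<close> lies
    between \<open>l\<close> and \<open>r\<close>; expanding and collecting \<open>c * D\<close>
    gives the difference of the two sides.\<close>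
  then have "0 \<le> ((c - l) * std_normal_density l + (r - c) * std_normal_density r) * D"
    using D by (intro mult_nonneg_nonneg add_nonneg_nonneg normal_density_nonneg) auto
  also have "\<dots> = (c * D) * (std_normal_density l - std_normal_density r)
      - (l * std_normal_density l - r * std_normal_density r) * D"
    by (simp add: algebra_simps)
  finally show ?thesis
    unfolding cD by (simp add: power2_eq_square algebra_simps)
qed

lemma convex_neg_ln_std_normal_interval:
  assumes "\<alpha> < \<beta>"
  shows "convex_on UNIV (\<lambda>x. - ln (std_normal_cdf (\<beta> + x) - std_normal_cdf (\<alpha> + x)))"
proof (rule f''_ge0_imp_convex)
  let ?g = "\<lambda>x. std_normal_cdf (\<beta> + x) - std_normal_cdf (\<alpha> + x)"
  let ?g' = "\<lambda>x. std_normal_density (\<beta> + x) - std_normal_density (\<alpha> + x)"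
  let ?g'' = "\<lambda>x. (\<alpha> + x) * std_normal_density (\<alpha> + x) - (\<beta> + x) * std_normal_density (\<beta> + x)"
  have g: "?g x > 0" for x
    using std_normal_cdf_strict_mono[of "\<alpha> + x" "\<beta> + x"] assms by simp
  have Dg: "(?g has_real_derivative ?g' x) (at x)" for x
    by (auto intro!: derivative_eq_intros)
  have Dg': "(?g' has_real_derivative ?g'' x) (at x)" for x
    by (auto intro!: derivative_eq_intros simp: algebra_simps)
  show "((\<lambda>x. - ln (?g x)) has_real_derivative - (?g' x / ?g x)) (at x)" for x
    using g[of x] by (auto intro!: derivative_eq_intros Dg simp: field_simps)
  show "((\<lambda>x. - (?g' x / ?g x)) has_real_derivative - ((?g'' x * ?g x - ?g' x * ?g' x) / (?g x * ?g x)))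
      (at x)" for x
    using g[of x] by (intro DERIV_minus DERIV_divide Dg Dg') auto
  show "- ((?g'' x * ?g x - ?g' x * ?g' x) / (?g x * ?g x)) \<ge> 0" for x
    using std_normal_interval_second_derivative_bound[of "\<alpha> + x" "\<beta> + x"] assms g[of x]
    by (simp add: divide_nonpos_nonneg power2_eq_square)
qed auto

section \<open>Passage to infinite end points\<close>

lemma Phi_ereal [simp]: "Phi (ereal x) = std_normal_cdf x"
  and Phi_PInfty [simp]: "Phi \<infinity> = 1"
  and Phi_MInfty [simp]: "Phi (- \<infinity>) = 0"
  unfolding Phi_def by simp_all

lemma Phi_mono: "x \<le> y \<Longrightarrow> Phi x \<le> Phi y"
  by (cases x; cases y)
     (auto simp: std_normal.cdf_nondecreasing std_normal.cdf_nonneg std_normal.cdf_bounded_prob)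

text \<open>Two real points strictly between \<open>x\<close> and \<open>y\<close> reduce the claim
  to the real case, so infinite arguments need no separate treatment.\<close>

lemma Phi_strict_mono:
  assumes "x < y"
  shows "Phi x < Phi y"
proof -
  obtain p where p: "x < ereal p" "ereal p < y"
    using ereal_dense2[OF assms] by blast
  obtain r where r: "ereal p < ereal r" "ereal r < y"
    using ereal_dense2[OF p(2)] by blast
  have "Phi x \<le> std_normal_cdf p"
    using Phi_mono[of x "ereal p"] p by simp
  also have "\<dots> < std_normal_cdf r"
    using r by (intro std_normal_cdf_strict_mono) simp
  also have "\<dots> \<le> Phi y"
    using Phi_mono[of "ereal r" y] r by simp
  finally show ?thesis .
qed

text \<open>At a real limit this is continuity of the distribution function; at an infinite limit it
  is the convergence of its tails to 1 and 0.\<close>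

lemma tendsto_Phi:
  assumes "((\<lambda>n. ereal (a n)) \<longlongrightarrow> L) G"
  shows "((\<lambda>n. std_normal_cdf (a n)) \<longlongrightarrow> Phi L) G"
proof (cases L)
  case (real r)
  then have "(a \<longlongrightarrow> r) G" using assms by simp
  then show ?thesis
    using isCont_tendsto_compose[OF DERIV_isCont[OF DERIV_std_normal_cdf]] real by simp
next
  case PInf
  then have "filterlim a at_top G"
    using assms by (simp add: tendsto_PInfty_eq_at_top)
  then show ?thesis
    using filterlim_compose[OF std_normal.cdf_lim_at_top_prob] PInf by simp
next
  case MInf
  then have "filterlim a at_bot G"
    using assms by (simp add: ereal_tendsto_simps2(3)[unfolded comp_def])
  then show ?thesis
    using filterlim_compose[OF std_normal.cdf_lim_at_bot] MInf by simp
qed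

lemma ereal_limit_of_reals:
  obtains a :: "nat \<Rightarrow> real" where "(\<lambda>n. ereal (a n)) \<longlonglongrightarrow> L"
proof (cases L)
  case (real r)
  then show ?thesis using that[of "\<lambda>_. r"] by simp
next
  case PInf
  then show ?thesis
    using that[of real] filterlim_real_sequentially by (simp add: tendsto_PInfty_eq_at_top)
next
  case MInf
  then show ?thesis
    using that[of "\<lambda>n. - real n"] filterlim_real_sequentially
    by (simp add: ereal_tendsto_simps2(3)[unfolded comp_def] flip: filterlim_uminus_at_top)
qed

text \<open>The convexity inequality is non-strict and involves three points, so it survives
  pointwise limits. Convexity is asked only eventually because approximating end points may be in
  the wrong order at first.\<close>

lemma convex_on_pointwise_limit:
  fixes f :: "'a::real_vector \<Rightarrow> real"
  assumes "G \<noteq> bot" "eventually (\<lambda>n. convex_on S (F n)) G"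
    and lim: "\<And>x. x \<in> S \<Longrightarrow> ((\<lambda>n. F n x) \<longlongrightarrow> f x) G" and "convex S"
  shows "convex_on S f"
proof (rule convex_onI)
  fix u :: real and x y assume *: "0 < u" "u < 1" "x \<in> S" "y \<in> S"
  then have z: "(1 - u) *\<^sub>R x + u *\<^sub>R y \<in> S"
    using \<open>convex S\<close> by (intro convexD) auto
  show "f ((1 - u) *\<^sub>R x + u *\<^sub>R y) \<le> (1 - u) * f x + u * f y"
  proof (rule tendsto_le[OF \<open>G \<noteq> bot\<close>])
    show "((\<lambda>n. F n ((1 - u) *\<^sub>R x + u *\<^sub>R y)) \<longlongrightarrow> f ((1 - u) *\<^sub>R x + u *\<^sub>R y)) G"
      by (rule lim[OF z])
    show "((\<lambda>n. (1 - u) * F n x + u * F n y) \<longlongrightarrow> (1 - u) * f x + u * f y) G"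
      using * by (intro tendsto_intros lim)
    show "eventually (\<lambda>n. F n ((1 - u) *\<^sub>R x + u *\<^sub>R y) \<le> (1 - u) * F n x + u * F n y) G"
      using assms(2) by eventually_elim (use * in \<open>auto intro!: convex_onD\<close>)
  qed
qed (rule \<open>convex S\<close>)

lemma convex_neg_ln_Phi_interval:
  assumes "A < B"
  shows "convex_on UNIV (\<lambda>x. - ln (Phi (B + ereal x) - Phi (A + ereal x)))"
proof -
  obtain \<alpha> where \<alpha>: "(\<lambda>n. ereal (\<alpha> n)) \<longlonglongrightarrow> A" by (rule ereal_limit_of_reals)
  obtain \<beta> where \<beta>: "(\<lambda>n. ereal (\<beta> n)) \<longlonglongrightarrow> B" by (rule ereal_limit_of_reals)
  \<comment> \<open>The level \<open>m\<close> separates the two sequences from some index on, which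
    puts the real end points in the order needed for the bounded case.\<close>
  obtain m where "A < m" "m < B" using dense[OF assms] by blast
  then have "eventually (\<lambda>n. ereal (\<alpha> n) < m) sequentially"
    "eventually (\<lambda>n. m < ereal (\<beta> n)) sequentially"
    using order_tendstoD \<alpha> \<beta> by blast+
  then have ev: "eventually (\<lambda>n. \<alpha> n < \<beta> n) sequentially"
    by eventually_elim (metis less_trans ereal_less(1) less_ereal.simps(1))
  have Phi_lim: "(\<lambda>n. std_normal_cdf (a n + x)) \<longlonglongrightarrow> Phi (L + ereal x)"
    if "(\<lambda>n. ereal (a n)) \<longlonglongrightarrow> L" for a L x
  proof (rule tendsto_Phi)
    show "(\<lambda>n. ereal (a n + x)) \<longlonglongrightarrow> L + ereal x"
      using tendsto_add_ereal_general[OF _ that tendsto_const, of "ereal x"] by simp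
  qed
  show ?thesis
  proof (rule convex_on_pointwise_limit)
    show "eventually (\<lambda>n. convex_on UNIV
        (\<lambda>x. - ln (std_normal_cdf (\<beta> n + x) - std_normal_cdf (\<alpha> n + x)))) sequentially"
      using ev by eventually_elim (rule convex_neg_ln_std_normal_interval)
    show "(\<lambda>n. - ln (std_normal_cdf (\<beta> n + x) - std_normal_cdf (\<alpha> n + x)))
        \<longlonglongrightarrow> - ln (Phi (B + ereal x) - Phi (A + ereal x))" for x
    proof (intro tendsto_intros Phi_lim \<alpha> \<beta>)
      \<comment> \<open>The limit of the logarithms requires a nonzero limit of the arguments; a
        finite shift keeps \<open>A\<close> and \<open>B\<close> distinct, so the limiting
        probability is positive.\<close>
      have "A + ereal x < B + ereal x"
        using assms by (cases A; cases B) auto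
      then show "Phi (B + ereal x) - Phi (A + ereal x) \<noteq> 0"
        using Phi_strict_mono by force
    qed
  qed auto
qed

section \<open>From one bin to the likelihood of a label vector\<close>

lemma convex_on_compose_linear:
  fixes g :: "'b::real_vector \<Rightarrow> real" and L :: "'a::real_vector \<Rightarrow> 'b"
  assumes "convex_on UNIV g" "linear L"
  shows "convex_on UNIV (\<lambda>x. g (L x))"
proof (rule convex_onI)
  fix t :: real and x y :: 'a
  assume "0 < t" "t < 1"
  then show "g (L ((1 - t) *\<^sub>R x + t *\<^sub>R y)) \<le> (1 - t) * g (L x) + t * g (L y)"
    using convex_onD[OF assms(1), of t "L x" "L y"] by (simp add: linear_add linear_scale assms(2))
qed auto

lemma
  assumes "N0 > 0" "b k < b (k + 1)"
  shows bin_likelihood_pos: "bin_likelihood b N0 k x > 0"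
    and convex_neg_ln_bin_likelihood: "convex_on UNIV (\<lambda>x. - ln (bin_likelihood b N0 k x))"
proof -
  define s where "s = sqrt (N0 / 2)"
  have s: "s > 0" using assms(1) by (simp add: s_def)
  \<comment> \<open>Dividing by the noise scale turns the signal into a common shift
    \<open>- x / s\<close> of both end points, linear in \<open>x\<close>, also when an end point is
    infinite.\<close>
  have affine: "(B - ereal x) / ereal s = B / ereal s + ereal (- x / s)" for B x
    using s by (cases B) (auto simp: diff_divide_distrib)
  have less: "b k / ereal s < b (k + 1) / ereal s"
    using s assms(2) by (cases "b k"; cases "b (k + 1)") (auto simp: divide_strict_right_mono)
  have eq: "bin_likelihood b N0 k x
      = Phi (b (k + 1) / ereal s + ereal (- x / s)) - Phi (b k / ereal s + ereal (- x / s))" for x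
    by (simp only: bin_likelihood_def Let_def affine flip: s_def)
  have "b k / ereal s + ereal (- x / s) < b (k + 1) / ereal s + ereal (- x / s)"
    using less by (cases "b k / ereal s"; cases "b (k + 1) / ereal s") auto
  then show "bin_likelihood b N0 k x > 0"
    unfolding eq using Phi_strict_mono by simp
  show "convex_on UNIV (\<lambda>x. - ln (bin_likelihood b N0 k x))"
    unfolding eq using convex_neg_ln_Phi_interval[OF less]
    by (rule convex_on_compose_linear) (auto intro!: linearI simp: add_divide_distrib)
qed

lemma
  assumes "N0 > 0" "bin_boundaries Q b" "q \<in> labels Q"
  shows likelihood_pos: "likelihood b N0 q z > 0"
    and convex_neg_ln_likelihood: "convex_on UNIV (\<lambda>z. - ln (likelihood b N0 q z))"
proof -
  obtain k l where q: "q = of_nat k + \<i> * of_nat l" "k \<in> {1..Q}" "l \<in> {1..Q}"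
    using assms(3) by (auto simp: labels_def)
  \<comment> \<open>The boundaries are strictly increasing up to index \<open>Q + 1\<close>, so the
    last bin \<open>j = Q\<close> is covered too.\<close>
  have step: "b j < b (j + 1)" if "j \<in> {1..Q}" for j
    using assms(2) that by (auto simp: bin_boundaries_def intro: strict_mono_onD)
  have eq: "likelihood b N0 q z = bin_likelihood b N0 k (Re z) * bin_likelihood b N0 l (Im z)" for z
    by (simp add: likelihood_def q)
  note pos = bin_likelihood_pos[OF assms(1) step[OF q(2)]] bin_likelihood_pos[OF assms(1) step[OF q(3)]]
  show "likelihood b N0 q z > 0"
    using pos by (simp add: eq)
  have "convex_on UNIV
      (\<lambda>z. - ln (bin_likelihood b N0 k (Re z)) + - ln (bin_likelihood b N0 l (Im z)))"
    by (intro convex_on_add convex_on_compose_linear[OF convex_neg_ln_bin_likelihood]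
        assms(1) step q(2,3) bounded_linear.linear bounded_linear_Re bounded_linear_Im)
  moreover have "- ln (likelihood b N0 q z)
      = - ln (bin_likelihood b N0 k (Re z)) + - ln (bin_likelihood b N0 l (Im z))" for z
    \<comment> \<open>Positivity of both factors lets the logarithm of the product split into a
      sum.\<close>
    unfolding eq using pos by (subst ln_mult_pos) auto
  ultimately show "convex_on UNIV (\<lambda>z. - ln (likelihood b N0 q z))"
    by simp
qed

lemma
  assumes "N0 > 0" "bin_boundaries Q b" "y \<in> label_vecs Q"
  shows likelihood_vec_pos: "likelihood_vec b N0 y z > 0"
    and convex_neg_ln_likelihood_vec: "convex_on UNIV (\<lambda>z. - ln (likelihood_vec b N0 y z))"
proof -
  have y: "y $ w \<in> labels Q" for w
    using assms(3) by (simp add: label_vecs_def)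
  note pos = likelihood_pos[OF assms(1,2) y]
  show "likelihood_vec b N0 y z > 0"
    by (simp add: likelihood_vec_def prod_pos pos)
  have summand: "convex_on UNIV (\<lambda>z. - ln (likelihood b N0 (y $ w) (z $ w)))" for w
    by (rule convex_on_compose_linear[OF convex_neg_ln_likelihood[OF assms(1,2) y]])
       (auto intro: linearI)
  have "convex_on UNIV (\<lambda>z. \<Sum>w\<in>I. - ln (likelihood b N0 (y $ w) (z $ w)))" for I
    using finite[of I]
  proof induction
    case (insert w I)
    then show ?case
      using convex_on_add[OF summand[of w] insert.IH] by simp
  qed (simp add: convex_on_const)
  moreover have "- ln (likelihood_vec b N0 y z) = (\<Sum>w\<in>UNIV. - ln (likelihood b N0 (y $ w) (z $ w)))"
    for z
    unfolding likelihood_vec_def sum_negf by (subst ln_prod) (auto simp: less_imp_neq[OF pos, symmetric])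
  ultimately show "convex_on UNIV (\<lambda>z. - ln (likelihood_vec b N0 y z))"
    by simp
qed

section \<open>Extended-valued sums and the objective\<close>

lemma ereal_convex_on_real_add:
  assumes "convex_on S g" "ereal_convex_on S k" "\<And>x. k x \<noteq> - \<infinity>"
  shows "ereal_convex_on S (\<lambda>x. ereal (g x) + k x)"
  unfolding ereal_convex_on_def
proof (intro conjI ballI allI impI)
  show "convex S" using assms(2) by (simp add: ereal_convex_on_def)
  fix x y and u v :: real
  assume *: "x \<in> S" "y \<in> S" "0 \<le> u" "0 \<le> v" "u + v = 1"
  let ?z = "u *\<^sub>R x + v *\<^sub>R y"
  have g: "g ?z \<le> u * g x + v * g y"
    using assms(1) * unfolding convex_on_def by blast
  have k: "k ?z \<le> ereal u * k x + ereal v * k y"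
    using assms(2) * unfolding ereal_convex_on_def by blast
  have "ereal (g ?z) + k ?z \<le> ereal (u * g x + v * g y) + (ereal u * k x + ereal v * k y)"
    using g k by (intro add_mono) auto
  also have "\<dots> = ereal u * (ereal (g x) + k x) + ereal v * (ereal (g y) + k y)"
    \<comment> \<open>A positive weight on an infinite value makes both sides infinite, while a zero
      weight removes the term since \<open>0 * \<infinity> = 0\<close>. Excluding
      \<open>- \<infinity>\<close> rules out sums of opposite infinities.\<close>
    using assms(3)[of x] assms(3)[of y] *(3,4)
    by (cases "k x"; cases "k y"; cases "u = 0"; cases "v = 0") (auto simp: algebra_simps)
  finally show "ereal (g ?z) + k ?z
      \<le> ereal u * (ereal (g x) + k x) + ereal v * (ereal (g y) + k y)" .
qed

theorem mainTheorem2: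
  fixes M :: "'a measure"
    and Q :: nat and b :: "nat \<Rightarrow> ereal" and N0 :: real
    and idx :: "'w::finite \<Rightarrow> nat"
    and t :: "complex ^ 'w" and T :: "complex ^ 'w ^ 'w"
    and h n q :: "'a \<Rightarrow> complex ^ 'w"
    and f :: "complex ^ 'w \<Rightarrow> real"
  assumes "prob_space M"
    and "Q \<ge> 1" and "bin_boundaries Q b"
    and "N0 > 0"
    and "bij_betw idx UNIV {..<CARD('w)}"
    and "T = conj_transpose (dft_matrix idx) ** diag_matrix t"
    and "prob_space.indep_vars M (\<lambda>_. borel) (\<lambda>w \<omega>. n \<omega> $ w) UNIV"
    and "\<And>w. distributed M lborel (\<lambda>\<omega>. n \<omega> $ w) (\<lambda>z. ennreal (complex_normal_density N0 z))"
    and "\<And>x. f x \<ge> 0"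
    and "distributed M lborel h (\<lambda>x. ennreal (f x))"
    and "\<And>\<omega>. \<omega> \<in> space M \<Longrightarrow> q \<omega> = quantize_vec Q b (T *v h \<omega> + n \<omega>)"
    and "log_concave_fun f"
  shows "\<forall>y \<in> label_vecs Q. ereal_convex_on UNIV (map_objective b N0 T f y)"
proof
  fix y :: "complex ^ 'w" assume y: "y \<in> label_vecs Q"
  note lik = \<open>N0 > 0\<close> \<open>bin_boundaries Q b\<close> y
  \<comment> \<open>Linearity over the reals, matching convexity on the underlying real space of
    dimension 2W.\<close>
  have "linear ((*v) T)"
    by (rule linearI)
       (simp_all add: matrix_vector_mult_def vec_eq_iff scaleR_sum_right ring_distribs sum.distrib)
  then have "convex_on UNIV (\<lambda>x. - ln (likelihood_vec b N0 y (T *v x)))"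
    by (rule convex_on_compose_linear[OF convex_neg_ln_likelihood_vec[OF lik]])
  then have "ereal_convex_on UNIV
      (\<lambda>x. ereal (- ln (likelihood_vec b N0 y (T *v x))) + neg_log (f x))"
    using \<open>log_concave_fun f\<close>[unfolded log_concave_fun_def]
    by (rule ereal_convex_on_real_add) (simp add: neg_log_def)
  \<comment> \<open>The likelihood is strictly positive, so its \<open>neg_log\<close> is finite and
    the objective can be infinite only where \<open>f\<close> vanishes.\<close>
  moreover have "map_objective b N0 T f y
      = (\<lambda>x. ereal (- ln (likelihood_vec b N0 y (T *v x))) + neg_log (f x))"
    by (simp add: map_objective_def neg_log_def fun_eq_iff
        likelihood_vec_pos[OF lik, THEN iffD2[OF not_le]])
  ultimately show "ereal_convex_on UNIV (map_objective b N0 T f y)"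
    by simp
qed

end
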